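(* Let $n\ge 6$ be an integer. There exists a zigzag trichord cycle in $\mathbb{Z}_n$ if and only if $3\mid n$ and $n\notin\{6,12\}$.
   Context: For $2\le k\le n-2$ let $T_k$ be the transposition class of the set $\{0,1,k\}\subset\mathbb{Z}_n$, i.e. all sets $\{x,x+1,x+k\}$, $x\in\mathbb{Z}_n$. A trichord cycle in $\mathbb{Z}_n$ is a cyclic word $c_0c_1\cdots c_{m-1}$ over $\mathbb{Z}_n$ with $m=n-3$ (letters may repeat) such that the $m$ windows $W_i=\{c_i,c_{i+1},c_{i+2}\}$ (indices mod $m$) are three-element sets and each class $T_k$, $2\le k\le n-2$, contains exactly one of the windows. The chromatic window is the unique $W_i$ belonging to $T_2$. The cycle is scalar if the ordered triple $(c_i,c_{i+1},c_{i+2})$ of the chromatic window is a translate of $(0,1,2)$ or of $(2,1,0)$, and zigzag otherwise. *)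

theory Defs
  imports Main
begin

text \<open>
  Elements of \<open>\<int>\<^sub>n\<close> are represented by their residues in \<open>{0..<int n}\<close>.
  A cyclic word is represented by any of the lists obtained by cutting it open;
  positions are read modulo the length of the list, and all notions below are
  invariant under rotation.
\<close>

definition translate :: "nat \<Rightarrow> int \<Rightarrow> int \<Rightarrow> int" where
  "translate n x y = (x + y) mod int n"

definition transp_class :: "nat \<Rightarrow> int set \<Rightarrow> int set set" where
  "transp_class n A = {translate n x ` A | x. x \<in> {0..<int n}}"

definition T_class :: "nat \<Rightarrow> int \<Rightarrow> int set set" where
  "T_class n k = transp_class n {0, 1, k}"

definition cyc_nth :: "int list \<Rightarrow> nat \<Rightarrow> int" where
  "cyc_nth c i = c ! (i mod length c)"

definition window_triple :: "int list \<Rightarrow> nat \<Rightarrow> int \<times> int \<times> int" where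
  "window_triple c i = (cyc_nth c i, cyc_nth c (i + 1), cyc_nth c (i + 2))"

definition window :: "int list \<Rightarrow> nat \<Rightarrow> int set" where
  "window c i = {cyc_nth c i, cyc_nth c (i + 1), cyc_nth c (i + 2)}"

definition trichord_cycle :: "nat \<Rightarrow> int list \<Rightarrow> bool" where
  "trichord_cycle n c \<longleftrightarrow>
     length c = n - 3 \<and>
     set c \<subseteq> {0..<int n} \<and>
     (\<forall>i<length c. card (window c i) = 3) \<and>
     (\<forall>k\<in>{2..int n - 2}. \<exists>!i. i < length c \<and> window c i \<in> T_class n k)"

text \<open>The position of the chromatic window; only meaningful for trichord cycles.\<close>

definition chromatic_pos :: "nat \<Rightarrow> int list \<Rightarrow> nat" where
  "chromatic_pos n c = (THE i. i < length c \<and> window c i \<in> T_class n 2)"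

definition translate_triple :: "nat \<Rightarrow> int \<Rightarrow> int \<times> int \<times> int \<Rightarrow> int \<times> int \<times> int" where
  "translate_triple n x = (\<lambda>(a, b, d). (translate n x a, translate n x b, translate n x d))"

definition scalar_cycle :: "nat \<Rightarrow> int list \<Rightarrow> bool" where
  "scalar_cycle n c \<longleftrightarrow> trichord_cycle n c \<and>
     (\<exists>x\<in>{0..<int n}.
        window_triple c (chromatic_pos n c) = translate_triple n x (0, 1, 2) \<or>
        window_triple c (chromatic_pos n c) = translate_triple n x (2, 1, 0))"

definition zigzag_cycle :: "nat \<Rightarrow> int list \<Rightarrow> bool" where
  "zigzag_cycle n c \<longleftrightarrow> trichord_cycle n c \<and> \<not> scalar_cycle n c"

end

theory Submission
  imports Defs
begin

text \<open>
  Pass to the cyclic word of steps \<open>d\<^sub>i = c\<^sub>i\<^sub>+\<^sub>1 - c\<^sub>i\<close>: the window \<open>W\<^sub>i\<close> lies in \<open>T\<^sub>k\<close> iff \<open>(d\<^sub>i, d\<^sub>i\<^sub>+\<^sub>1)\<close> is one of the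
  six pairs of cyclically consecutive entries of \<open>(1, k - 1, -k)\<close> and \<open>(-1, k, 1 - k)\<close>.
  Give a step with residue \<open>d \<in> {2..n-2}\<close> the weight \<open>d\<close>, and the steps \<open>1\<close> and \<open>-1\<close> the weights
  \<open>1 - n\<close> and \<open>2n - 1\<close>.  For \<open>k \<ge> 3\<close> the weight then grows by \<open>k + 1 + n\<close> modulo 3 across every window
  in \<open>T\<^sub>k\<close>, however it is traversed, while a zigzag traversal of \<open>T\<^sub>2\<close> contributes \<open>n\<close> or \<open>-n\<close>.
  As the increments add up to 0 around the cycle, \<open>3\<close> divides \<open>n\<close>.  The cases \<open>n = 6\<close> and \<open>n = 12\<close>
  are excluded by a finite search, and explicit words of steps with sum 0 settle all others.
\<close>

section \<open>Windows described by pairs of steps\<close>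

text \<open>The first row runs round \<open>t, t + 1, t + k\<close> in this cyclic order, the second
  row in the opposite one. For \<open>k\<close> in \<open>{2..N - 2}\<close> all entries are reduced
  residues.\<close>

definition step_pairs :: "int \<Rightarrow> int \<Rightarrow> (int \<times> int) set" where
  "step_pairs N k = {(1, k - 1), (k - 1, N - k), (N - k, 1),
                     (N - 1, k), (k, N + 1 - k), (N + 1 - k, N - 1)}"

definition step :: "nat \<Rightarrow> int list \<Rightarrow> nat \<Rightarrow> int" where
  "step n c i = (cyc_nth c (i + 1) - cyc_nth c i) mod int n"

lemma mod_diff_eq_iff:
  fixes N :: int
  assumes "0 \<le> y" "y < N" "0 \<le> a" "a < N"
  shows "(y - x) mod N = a \<longleftrightarrow> y = (x + a) mod N"
proof -
  have "(y - x) mod N = a mod N \<longleftrightarrow> y mod N = (x + a) mod N"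
    by (simp add: mod_eq_dvd_iff algebra_simps)
  with assms show ?thesis by simp
qed

lemma triple_eq_cases:
  assumes "{x, y, z} = {p, q, r}" "q \<noteq> p" "r \<noteq> p" "r \<noteq> q"
  shows "(x, y, z) \<in> {(p, q, r), (p, r, q), (q, p, r), (q, r, p), (r, p, q), (r, q, p)}"
proof -
  have "x \<in> {p, q, r}" "y \<in> {p, q, r}" "z \<in> {p, q, r}"
    "p \<in> {x, y, z}" "q \<in> {x, y, z}" "r \<in> {x, y, z}"
    using assms(1) by blast+
  then show ?thesis
    using assms(2-4) by auto
qed

lemma T_class_iff:
  fixes n :: nat
  defines "N \<equiv> int n"
  assumes k: "k \<in> {2..N - 2}"
    and x: "x \<in> {0..<N}" and y: "y \<in> {0..<N}" and z: "z \<in> {0..<N}"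
  shows "{x, y, z} \<in> T_class n k \<longleftrightarrow> ((y - x) mod N, (z - y) mod N) \<in> step_pairs N k"
    (is "?L \<longleftrightarrow> ?R")
proof -
  have T: "?L \<longleftrightarrow> (\<exists>t\<in>{0..<N}. {x, y, z} = {t, (t + 1) mod N, (t + k) mod N})"
  proof -
    have "translate n t ` {0, 1, k} = {t, (t + 1) mod N, (t + k) mod N}" if "t \<in> {0..<N}" for t
      using that by (simp add: translate_def N_def)
    then show ?thesis
      unfolding T_class_def transp_class_def N_def[symmetric] mem_Collect_eq by metis
  qed
  have R: "?R \<longleftrightarrow>
      y = (x + 1) mod N \<and> z = (y + (k - 1)) mod N \<or>
      y = (x + (k - 1)) mod N \<and> z = (y + (N - k)) mod N \<or>
      y = (x + (N - k)) mod N \<and> z = (y + 1) mod N \<or>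
      y = (x + (N - 1)) mod N \<and> z = (y + k) mod N \<or>
      y = (x + k) mod N \<and> z = (y + (N + 1 - k)) mod N \<or>
      y = (x + (N + 1 - k)) mod N \<and> z = (y + (N - 1)) mod N"
    using k y z by (simp add: step_pairs_def mod_diff_eq_iff)
  have red: "(u + (N - v)) mod N = (u - v) mod N" "(u + (N + 1 - v)) mod N = (u + (1 - v)) mod N" for u v
  proof -
    show "(u + (N - v)) mod N = (u - v) mod N"
      by (simp add: mod_eq_dvd_iff)
    show "(u + (N + 1 - v)) mod N = (u + (1 - v)) mod N"
      by (simp add: mod_eq_dvd_iff)
  qed
  have xm: "x mod N = x" "y mod N = y" "z mod N = z" using x y z by auto
  show ?thesis
  proof
    assume ?L
    from T[THEN iffD1, OF this] obtain t where t: "t \<in> {0..<N}" and e: "{x, y, z} = {t, (t + 1) mod N, (t + k) mod N}"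
      by (rule bexE)
    have neq: "u mod N \<noteq> v mod N" if "0 < u - v" "u - v < N" for u v
      using that by (simp add: mod_eq_dvd_iff zdvd_not_zless)
    have tm: "t mod N = t" using t by simp
    have "(t + 1) mod N \<noteq> t mod N" "(t + k) mod N \<noteq> t mod N" "(t + k) mod N \<noteq> (t + 1) mod N"
      by (rule neq; use k in simp)+
    then have "(x, y, z) \<in> {(t, (t + 1) mod N, (t + k) mod N), (t, (t + k) mod N, (t + 1) mod N),
        ((t + 1) mod N, t, (t + k) mod N), ((t + 1) mod N, (t + k) mod N, t),
        ((t + k) mod N, t, (t + 1) mod N), ((t + k) mod N, (t + 1) mod N, t)}"
      by (intro triple_eq_cases[OF e]) (simp_all add: tm)
    then consider "x = t" "y = (t + 1) mod N" "z = (t + k) mod N"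
      | "x = t" "y = (t + k) mod N" "z = (t + 1) mod N"
      | "x = (t + 1) mod N" "y = t" "z = (t + k) mod N"
      | "x = (t + 1) mod N" "y = (t + k) mod N" "z = t"
      | "x = (t + k) mod N" "y = t" "z = (t + 1) mod N"
      | "x = (t + k) mod N" "y = (t + 1) mod N" "z = t"
      by (simp only: insert_iff prod.inject empty_iff) blast
    then have "y = (x + 1) mod N \<and> z = (y + (k - 1)) mod N \<or>
      y = (x + (k - 1)) mod N \<and> z = (y - k) mod N \<or>
      y = (x - k) mod N \<and> z = (y + 1) mod N \<or>
      y = (x - 1) mod N \<and> z = (y + k) mod N \<or>
      y = (x + k) mod N \<and> z = (y + (1 - k)) mod N \<or>
      y = (x + (1 - k)) mod N \<and> z = (y - 1) mod N"
      by cases (simp_all add: mod_simps tm)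
    then show ?R
      unfolding R red .
  next
    have w: ?L if "t \<in> {0..<N}" "{x, y, z} = {t, (t + 1) mod N, (t + k) mod N}" for t
      using that unfolding T by (rule bexI[rotated])
    assume ?R
    then consider
        "y = (x + 1) mod N" "z = (y + (k - 1)) mod N"
      | "y = (x + (k - 1)) mod N" "z = (y + (N - k)) mod N"
      | "y = (x + (N - k)) mod N" "z = (y + 1) mod N"
      | "y = (x + (N - 1)) mod N" "z = (y + k) mod N"
      | "y = (x + k) mod N" "z = (y + (N + 1 - k)) mod N"
      | "y = (x + (N + 1 - k)) mod N" "z = (y + (N - 1)) mod N"
      unfolding R by blast
    then show ?L
    proof cases
      case 1
      then show ?thesis by (intro w[OF x]) (auto simp: mod_simps)
    next
      case 2
      moreover have "x + (k - 1) = x - 1 + k" by simp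
      ultimately show ?thesis by (intro w[OF z]) (auto simp: red mod_simps xm)
    next
      case 3
      then show ?thesis by (intro w[OF y]) (auto simp: red mod_simps xm)
    next
      case 4
      then show ?thesis by (intro w[OF y]) (auto simp: red mod_simps xm)
    next
      case 5
      then show ?thesis by (intro w[OF x]) (auto simp: red mod_simps xm)
    next
      case 6
      moreover have "x + (1 - k) = x - k + 1" by simp
      ultimately show ?thesis by (intro w[OF z]) (auto simp: red mod_simps xm)
    qed
  qed
qed

text \<open>Distinct labels could share a pair only through forms that force a label such as
  \<open>N - 1\<close> or \<open>N\<close>, outside the range. Hence a window has at most one
  label.\<close>

lemma step_pairs_unique:
  assumes "p \<in> step_pairs N k" "p \<in> step_pairs N l" "k \<in> {2..N - 2}" "l \<in> {2..N - 2}"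
  shows "k = l"
proof -
  obtain a b where "p = (a, b)" by fastforce
  with assms show ?thesis
    unfolding step_pairs_def by (simp only: insert_iff prod.inject empty_iff atLeastAtMost_iff simp_thms)
      (elim disjE conjE; linarith)
qed

lemma cyc_nth_in_set: "c \<noteq> [] \<Longrightarrow> cyc_nth c i \<in> set c"
  by (simp add: cyc_nth_def)

lemma T_class_window_iff:
  assumes "set c \<subseteq> {0..<int n}" "c \<noteq> []" "k \<in> {2..int n - 2}"
  shows "window c i \<in> T_class n k \<longleftrightarrow> (step n c i, step n c (i + 1)) \<in> step_pairs (int n) k"
proof -
  have "cyc_nth c j \<in> {0..<int n}" for j
    using assms(1) cyc_nth_in_set[OF assms(2)] by blast
  then show ?thesis
    using T_class_iff[OF assms(3)] by (simp add: window_def step_def)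
qed

lemma step_mod: "step n c (i mod length c) = step n c i"
  unfolding step_def cyc_nth_def by (simp add: mod_Suc_eq)

text \<open>Uniqueness of labels makes the position map injective, and both sides have
  \<open>n - 3\<close> elements. Sums over windows thus become sums over labels.\<close>

lemma trichord_cycle_positions:
  assumes "trichord_cycle n c" "n \<ge> 6"
  obtains pos where "bij_betw pos {2..int n - 2} {..<n - 3}"
    "\<And>k. k \<in> {2..int n - 2} \<Longrightarrow> (step n c (pos k), step n c (pos k + 1)) \<in> step_pairs (int n) k"
    "pos 2 = chromatic_pos n c"
proof -
  define pos where "pos k = (THE i. i < length c \<and> window c i \<in> T_class n k)" for k
  have len: "length c = n - 3" and sub: "set c \<subseteq> {0..<int n}"
    and ex1: "\<And>k. k \<in> {2..int n - 2} \<Longrightarrow> \<exists>!i. i < length c \<and> window c i \<in> T_class n k"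
    using assms(1) unfolding trichord_cycle_def by blast+
  have ne: "c \<noteq> []" using len assms(2) by auto
  have pos: "pos k < n - 3 \<and> window c (pos k) \<in> T_class n k" if "k \<in> {2..int n - 2}" for k
    using theI'[OF ex1[OF that]] unfolding pos_def len .
  have sp: "(step n c (pos k), step n c (pos k + 1)) \<in> step_pairs (int n) k"
    if "k \<in> {2..int n - 2}" for k
    using pos[OF that] T_class_window_iff[OF sub ne that] by simp
  have inj: "inj_on pos {2..int n - 2}"
    using sp step_pairs_unique by (intro inj_onI) metis
  have "pos ` {2..int n - 2} = {..<n - 3}"
    using pos card_image[OF inj] assms(2) by (intro card_subset_eq) auto
  then have "bij_betw pos {2..int n - 2} {..<n - 3}"
    using inj by (simp add: bij_betw_def)
  then show thesis
    using that[of pos] sp by (simp add: pos_def chromatic_pos_def)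
qed

text \<open>Only two of the six traversals of the chromatic set are monotone. With
  \<open>N = int n\<close>, the zigzag ones are \<open>(1, N - 2)\<close>,
  \<open>(N - 2, 1)\<close>, \<open>(N - 1, 2)\<close> and \<open>(2, N - 1)\<close>.\<close>

lemma scalar_cycle_iff:
  assumes "trichord_cycle n c" "n \<ge> 6"
  shows "scalar_cycle n c \<longleftrightarrow>
    (step n c (chromatic_pos n c), step n c (chromatic_pos n c + 1)) \<in> {(1, 1), (int n - 1, int n - 1)}"
proof -
  define N where "N = int n"
  define p where "p = chromatic_pos n c"
  have sub: "set c \<subseteq> {0..<N}" and ne: "c \<noteq> []"
    using assms unfolding trichord_cycle_def N_def by auto
  have rng: "cyc_nth c j \<in> {0..<N}" for j
    using sub cyc_nth_in_set[OF ne] by blast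
  define x y z where "x = cyc_nth c p" and "y = cyc_nth c (p + 1)" and "z = cyc_nth c (p + 2)"
  have r: "x \<in> {0..<N}" "y \<in> {0..<N}" "z \<in> {0..<N}"
    using rng by (simp_all add: x_def y_def z_def)
  have xm: "x mod N = x" "y mod N = y" "z mod N = z" using r by auto
  have N: "N \<ge> 6" using assms(2) by (simp add: N_def)
  have 1: "(\<exists>t\<in>{0..<N}. x = t mod N \<and> y = (t + 1) mod N \<and> z = (t + 2) mod N) \<longleftrightarrow>
      y = (x + 1) mod N \<and> z = (y + 1) mod N"
    using r by (auto simp: mod_simps add.commute)
  have "x = (z + 2) mod N \<and> y = (z + 1) mod N \<longleftrightarrow>
        y = (x + (N - 1)) mod N \<and> z = (y + (N - 1)) mod N"
  proof (intro iffI; elim conjE)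
    assume "x = (z + 2) mod N" "y = (z + 1) mod N"
    then show "y = (x + (N - 1)) mod N \<and> z = (y + (N - 1)) mod N"
      using xm by (simp add: mod_simps algebra_simps flip: add_diff_eq)
  next
    assume a: "y = (x + (N - 1)) mod N" "z = (y + (N - 1)) mod N"
    have "(z + 1) mod N = y"
      unfolding a(2) using xm by (simp add: mod_simps)
    moreover have "(y + 1) mod N = x"
      unfolding a(1) using xm by (simp add: mod_simps)
    ultimately show "x = (z + 2) mod N \<and> y = (z + 1) mod N"
      by (metis mod_add_left_eq add.assoc one_add_one)
  qed
  then have 2: "(\<exists>t\<in>{0..<N}. x = (t + 2) mod N \<and> y = (t + 1) mod N \<and> z = t mod N) \<longleftrightarrow>
      y = (x + (N - 1)) mod N \<and> z = (y + (N - 1)) mod N"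
    using r xm by auto
  have "scalar_cycle n c \<longleftrightarrow> (\<exists>t\<in>{0..<N}. x = t mod N \<and> y = (t + 1) mod N \<and> z = (t + 2) mod N) \<or>
      (\<exists>t\<in>{0..<N}. x = (t + 2) mod N \<and> y = (t + 1) mod N \<and> z = t mod N)"
    unfolding scalar_cycle_def window_triple_def translate_triple_def translate_def x_def y_def z_def p_def N_def
    using assms(1) by auto
  also have "\<dots> \<longleftrightarrow> ((y - x) mod N, (z - y) mod N) \<in> {(1, 1), (N - 1, N - 1)}"
    unfolding 1 2 using r N by (simp add: mod_diff_eq_iff)
  finally show ?thesis
    by (simp add: step_def x_def y_def z_def N_def p_def)
qed


section \<open>The obstruction modulo 3\<close>

lemma step_periodic:
  assumes "length c = m"
  shows "step n c (i + m) = step n c i"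
  using step_mod[of n c "i + m"] step_mod[of n c i] assms by simp

lemma sum_step_mod:
  assumes "length c = m"
  shows "(\<Sum>j<m. step n c (p + j)) mod int n = 0"
proof -
  have "(\<Sum>j<m. step n c (p + j)) mod int n =
      (\<Sum>j<m. cyc_nth c (p + Suc j) - cyc_nth c (p + j)) mod int n"
    unfolding step_def by (simp add: mod_sum_eq)
  also have "(\<Sum>j<m. cyc_nth c (p + Suc j) - cyc_nth c (p + j)) = cyc_nth c (p + m) - cyc_nth c p"
    using sum_lessThan_telescope[of "\<lambda>j. cyc_nth c (p + j)" m] by simp
  also have "\<dots> = 0"
    using assms by (simp add: cyc_nth_def)
  finally show ?thesis by simp
qed

lemma zigzag_imp_three_dvd:
  assumes "zigzag_cycle n c" "n \<ge> 6"
  shows "3 dvd n"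
proof -
  define N where "N = int n"
  \<comment> \<open>Modulo 3 the unit weights are forced: \<open>(k - 1, N - k)\<close> has
    increment \<open>N - 2 * k + 1\<close>, congruent to \<open>k + 1 + N\<close>, and
    \<open>(1, k - 1)\<close> and \<open>(N - 1, k)\<close> have to match it.\<close>
  define \<phi> where "\<phi> d = (if d = 1 then 1 - N else if d = N - 1 then 2 * N - 1 else d)" for d
  have tri: "trichord_cycle n c" and nscal: "\<not> scalar_cycle n c"
    using assms(1) by (simp_all add: zigzag_cycle_def)
  have len: "length c = n - 3" using tri by (simp add: trichord_cycle_def)
  have N: "N \<ge> 6" using assms(2) by (simp add: N_def)
  obtain pos where bij: "bij_betw pos {2..N - 2} {..<n - 3}"
    and sp: "\<And>k. k \<in> {2..N - 2} \<Longrightarrow> (step n c (pos k), step n c (pos k + 1)) \<in> step_pairs N k"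
    and p2: "pos 2 = chromatic_pos n c"
    using trichord_cycle_positions[OF tri assms(2)] unfolding N_def by blast
  define D where "D k = \<phi> (step n c (pos k + 1)) - \<phi> (step n c (pos k))" for k
  have "(\<Sum>k\<in>{2..N - 2}. D k) = (\<Sum>i<n - 3. \<phi> (step n c (Suc i)) - \<phi> (step n c i))"
    unfolding D_def using sum.reindex_bij_betw[OF bij, of "\<lambda>i. \<phi> (step n c (Suc i)) - \<phi> (step n c i)"]
    by simp
  also have "\<dots> = 0"
    using sum_lessThan_telescope[of "\<lambda>i. \<phi> (step n c i)" "n - 3"] step_periodic[OF len, of n 0]
    by simp
  finally have sum0: "(\<Sum>k\<in>{2..N - 2}. D k) = 0" .
  have D: "3 dvd D k - (k + 1 + N)" if k: "k \<in> {3..N - 2}" for k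
  proof -
    have "(step n c (pos k), step n c (pos k + 1)) \<in> step_pairs N k"
      using k by (intro sp) simp
    moreover have "\<phi> 1 = 1 - N" "\<phi> (N - 1) = 2 * N - 1" "\<phi> k = k" "\<phi> (k - 1) = k - 1"
      "\<phi> (N - k) = N - k" "\<phi> (N + 1 - k) = N + 1 - k"
      using k N by (auto simp: \<phi>_def)
    ultimately have "D k \<in> {k - 2 + N, N - 2 * k + 1, 1 - 2 * N + k, k - 2 * N + 1, N + 1 - 2 * k, k - 2 + N}"
      unfolding D_def step_pairs_def by auto
    then show ?thesis by (auto; presburger)
  qed
  \<comment> \<open>The scalar pairs would give increment 0 and hence no information on
    \<open>N\<close>.\<close>
  have D2: "3 dvd D 2 - N \<or> 3 dvd D 2 + N"
  proof -
    have "(step n c (pos 2), step n c (pos 2 + 1)) \<in> step_pairs N 2"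
      using N by (intro sp) simp
    moreover have "(step n c (pos 2), step n c (pos 2 + 1)) \<notin> {(1, 1), (N - 1, N - 1)}"
      using scalar_cycle_iff[OF tri assms(2)] nscal p2 by (simp add: N_def)
    moreover have "\<phi> 1 = 1 - N" "\<phi> (N - 1) = 2 * N - 1" "\<phi> 2 = 2" "\<phi> (N - 2) = N - 2"
      using N by (auto simp: \<phi>_def)
    ultimately have "D 2 \<in> {2 * N - 3, 3 - 2 * N}"
      unfolding D_def step_pairs_def by auto
    then show ?thesis by (auto; presburger)
  qed
  define S where "S = (\<Sum>k\<in>{3..N - 2}. k + 1 + N)"
  have "{2..N - 2} = insert 2 {3..N - 2}" using N by auto
  with sum0 have "(\<Sum>k\<in>{3..N - 2}. D k - (k + 1 + N)) = - D 2 - S"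
    by (simp add: sum_subtractf S_def)
  moreover have "3 dvd (\<Sum>k\<in>{3..N - 2}. D k - (k + 1 + N))"
    by (rule dvd_sum) (rule D)
  ultimately have "3 dvd - D 2 - S" by simp
  \<comment> \<open>So 3 divides \<open>S\<close> itself, and therefore \<open>D 2\<close>, which is
    congruent to \<open>N\<close> or \<open>- N\<close>.\<close>
  moreover have "2 * S = 3 * ((N - 4) * (N + 1))"
  proof -
    have "2 * (\<Sum>k\<in>{3..M}. k + 1 + N) = (M - 2) * (2 * N + M + 5)" if "M \<ge> 2" for M
      using that
    proof (induction M rule: int_ge_induct)
      case base
      then show ?case by simp
    next
      case (step i)
      have "{3..i + 1} = insert (i + 1) {3..i}" using step.hyps by auto
      then show ?case using step.IH by (simp add: algebra_simps)
    qed
    from this[of "N - 2"] N show ?thesis by (simp add: S_def algebra_simps)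
  qed
  ultimately have "3 dvd N"
    using D2 by presburger
  then show ?thesis unfolding N_def by presburger
qed

section \<open>Finite search for the moduli 6 and 12\<close>

text \<open>
  Search for a walk of \<open>m\<close> further windows which starts with step \<open>a\<close> and ends with step \<open>e\<close>, has
  its windows in distinct classes with labels from \<open>ks\<close>, and returns to its starting pitch; \<open>s\<close> is the
  sum of the steps preceding \<open>a\<close>.
\<close>

primrec closes :: "int \<Rightarrow> int \<Rightarrow> nat \<Rightarrow> int list \<Rightarrow> int \<Rightarrow> int \<Rightarrow> bool" where
  "closes N e 0 ks a s \<longleftrightarrow> a = e \<and> s mod N = 0"
| "closes N e (Suc m) ks a s \<longleftrightarrow>
     list_ex (\<lambda>k. list_ex (\<lambda>(p, b). p = a \<and> closes N e m (remove1 k ks) b (s + a))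
       [(1, k - 1), (k - 1, N - k), (N - k, 1), (N - 1, k), (k, N + 1 - k), (N + 1 - k, N - 1)]) ks"

text \<open>Completeness of the search: peel off the first window; by injectivity of
  \<open>l\<close> the later labels survive the removal of \<open>l 0\<close>.\<close>

lemma closes_walk:
  assumes "\<And>j. j < m \<Longrightarrow> (e j, e (Suc j)) \<in> step_pairs N (l j)"
    and "inj_on l {..<m}" "l ` {..<m} \<subseteq> set ks"
    and "(s + (\<Sum>j<m. e j)) mod N = 0"
  shows "closes N (e m) m ks (e 0) s"
  using assms
proof (induction m arbitrary: e l ks s)
  case 0
  then show ?case by simp
next
  case (Suc m)
  have "closes N (e (Suc m)) m (remove1 (l 0) ks) (e (Suc 0)) (s + e 0)"
  proof (rule Suc.IH[of "\<lambda>j. e (Suc j)" "\<lambda>j. l (Suc j)"])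
    show "inj_on (\<lambda>j. l (Suc j)) {..<m}"
      using Suc.prems(2) by (auto simp: inj_on_def)
    show "(\<lambda>j. l (Suc j)) ` {..<m} \<subseteq> set (remove1 (l 0) ks)"
    proof
      fix k assume "k \<in> (\<lambda>j. l (Suc j)) ` {..<m}"
      then obtain j where j: "j < m" "k = l (Suc j)" by auto
      then have "k \<noteq> l 0" using inj_onD[OF Suc.prems(2), of "Suc j" 0] by auto
      moreover have "k \<in> set ks" using j Suc.prems(3) by auto
      ultimately show "k \<in> set (remove1 (l 0) ks)" by simp
    qed
    show "(s + e 0 + (\<Sum>j<m. e (Suc j))) mod N = 0"
      using Suc.prems(4) by (simp add: sum.lessThan_Suc_shift add.assoc del: sum.lessThan_Suc)
  qed (use Suc.prems(1) in auto)
  moreover have "(e 0, e (Suc 0)) \<in> step_pairs N (l 0)" "l 0 \<in> set ks"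
    using Suc.prems(1,3) by auto
  ultimately show ?case
    by (auto simp: list_ex_iff step_pairs_def)
qed

text \<open>Cut the cycle at its chromatic window with steps \<open>a\<close>, \<open>b\<close>. The
  other \<open>n - 4\<close> windows form a walk that starts with \<open>b\<close> and ends with
  \<open>a\<close> again; that last \<open>a\<close> is counted only once, in the initial
  sum.\<close>

lemma zigzag_imp_closes:
  assumes "zigzag_cycle n c" "n \<ge> 6"
  defines "N \<equiv> int n"
  shows "\<exists>(a, b)\<in>{(1, N - 2), (N - 2, 1), (N - 1, 2), (2, N - 1)}. closes N a (n - 4) [3..N - 2] b a"
proof -
  have tri: "trichord_cycle n c" and nscal: "\<not> scalar_cycle n c"
    using assms(1) by (simp_all add: zigzag_cycle_def)
  have len: "length c = n - 3" using tri by (simp add: trichord_cycle_def)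
  have N: "N \<ge> 6" using assms(2) by (simp add: N_def)
  obtain pos where bij: "bij_betw pos {2..N - 2} {..<n - 3}"
    and sp: "\<And>k. k \<in> {2..N - 2} \<Longrightarrow> (step n c (pos k), step n c (pos k + 1)) \<in> step_pairs N k"
    and p2: "pos 2 = chromatic_pos n c"
    using trichord_cycle_positions[OF tri assms(2)] unfolding N_def by blast
  \<comment> \<open>\<open>l j\<close> is the label of the window \<open>j\<close> places after the
    chromatic one.\<close>
  define p e l where "p = pos 2" and "e j = step n c (p + j)"
    and "l j = inv_into {2..N - 2} pos ((p + j) mod (n - 3))" for j
  have p: "p < n - 3" using bij N unfolding p_def bij_betw_def by auto
  have lpos: "pos (l j) = (p + j) mod (n - 3)" and lk: "l j \<in> {2..N - 2}" for j
  proof -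
    have "(p + j) mod (n - 3) \<in> pos ` {2..N - 2}"
      using bij p unfolding bij_betw_def by auto
    then show "pos (l j) = (p + j) mod (n - 3)" "l j \<in> {2..N - 2}"
      unfolding l_def by (fact f_inv_into_f, fact inv_into_into)
  qed
  have el: "(e j, e (Suc j)) \<in> step_pairs N (l j)" for j
    using sp[OF lk[of j]] step_mod[of n c "p + j"] step_mod[of n c "(p + j) mod (n - 3) + 1"]
      step_mod[of n c "p + j + 1"]
    by (simp add: lpos e_def len mod_Suc_eq)
  have injl: "inj_on l {..<n - 3}"
  proof (rule inj_onI)
    fix i j assume ij: "i \<in> {..<n - 3}" "j \<in> {..<n - 3}" "l i = l j"
    then have "(p + i) mod (n - 3) = (p + j) mod (n - 3)" by (metis lpos)
    then have "(int p + int i) mod int (n - 3) = (int p + int j) mod int (n - 3)"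
      by (simp flip: of_nat_add of_nat_mod)
    then have "int i mod int (n - 3) = int j mod int (n - 3)"
      by (simp add: mod_eq_dvd_iff)
    with ij(1,2) show "i = j" by simp
  qed
  have "pos (l 0) = pos 2"
    using lpos[of 0] p unfolding p_def by simp
  then have l0: "l 0 = 2"
    using bij lk[of 0] N by (auto simp: bij_betw_def dest: inj_onD)
  have e0: "(e 0, e 1) \<in> {(1, N - 2), (N - 2, 1), (N - 1, 2), (2, N - 1)}"
  proof -
    have "(e 0, e 1) \<notin> {(1, 1), (N - 1, N - 1)}"
      using scalar_cycle_iff[OF tri assms(2)] nscal p2 by (simp add: N_def p_def e_def)
    then show ?thesis using el[of 0] l0 by (auto simp: step_pairs_def)
  qed
  have m: "n - 3 = Suc (n - 4)" using assms(2) by simp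
  have "closes N (e (Suc (n - 4))) (n - 4) [3..N - 2] (e (Suc 0)) (e 0)"
  proof (rule closes_walk[of "n - 4" "\<lambda>j. e (Suc j)" N "\<lambda>j. l (Suc j)"])
    show "inj_on (\<lambda>j. l (Suc j)) {..<n - 4}"
      using injl unfolding m by (auto simp: inj_on_def)
    show "(\<lambda>j. l (Suc j)) ` {..<n - 4} \<subseteq> set [3..N - 2]"
    proof
      fix k assume "k \<in> (\<lambda>j. l (Suc j)) ` {..<n - 4}"
      then obtain j where j: "j < n - 4" "k = l (Suc j)" by auto
      then have "k \<noteq> 2" using inj_onD[OF injl, of "Suc j" 0] l0 m by auto
      then show "k \<in> set [3..N - 2]" using lk[of "Suc j"] j by auto
    qed
    show "(e 0 + (\<Sum>j<n - 4. e (Suc j))) mod N = 0"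
      using sum_step_mod[OF len, of n p] unfolding m sum.lessThan_Suc_shift by (simp add: e_def N_def)
  qed (use el in auto)
  moreover have "e (Suc (n - 4)) = e 0"
    using step_periodic[OF len, of n p] m by (simp add: e_def)
  ultimately show ?thesis using e0 by (auto; metis)
qed

lemma no_closes_6:
  "\<not> (\<exists>(a, b)\<in>{(1, 4), (4, 1), (5, 2), (2, 5)}. closes 6 a 2 [3..4] b a)"
  by code_simp

lemma no_closes_12:
  "\<not> (\<exists>(a, b)\<in>{(1, 10), (10, 1), (11, 2), (2, 11)}. closes 12 a 8 [3..10] b a)"
  by code_simp

section \<open>Adjacent pairs in words built from blocks\<close>

text \<open>For a cyclic word \<open>ds\<close> the closing pair is included by taking
  \<open>adj (ds @ [hd ds])\<close>.\<close>

definition adj :: "'a list \<Rightarrow> ('a \<times> 'a) set" where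
  "adj xs = set (zip xs (tl xs))"

lemma adj_simps [simp]:
  "adj [x] = {}" "adj (x # y # zs) = insert (x, y) (adj (y # zs))"
  by (simp_all add: adj_def)

lemma adj_Cons: "zs \<noteq> [] \<Longrightarrow> adj (x # zs) = insert (x, hd zs) (adj zs)"
  by (cases zs) simp_all

lemma adj_append: "adj (xs @ y # ys) = adj (xs @ [y]) \<union> adj (y # ys)"
  by (induction xs) (simp_all add: adj_Cons hd_append)

text \<open>Every block starts with \<open>e\<close>, so whatever follows a block also starts with
  \<open>e\<close>, and the blocks contribute independently of each other.\<close>

lemma adj_blocks:
  assumes "\<And>j. hd (f j) = e" "\<And>j. f j \<noteq> []"
  shows "adj (concat (map f [0..<m]) @ e # ys) = (\<Union>j<m. adj (f j @ [e])) \<union> adj (e # ys)"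
proof (induction m arbitrary: ys)
  case 0
  then show ?case by simp
next
  case (Suc m)
  have f: "f m = e # tl (f m)" using assms by (metis list.collapse)
  have "adj (concat (map f [0..<Suc m]) @ e # ys) =
      adj (concat (map f [0..<m]) @ e # (tl (f m) @ e # ys))"
    using f by simp (metis append_Cons)
  also have "\<dots> = (\<Union>j<m. adj (f j @ [e])) \<union> adj ((e # tl (f m)) @ e # ys)"
    unfolding Suc.IH by simp
  also have "\<dots> = (\<Union>j<Suc m. adj (f j @ [e])) \<union> adj (e # ys)"
    unfolding f[symmetric] adj_append[of "f m" e ys] by (auto simp: lessThan_Suc)
  finally show ?case .
qed

lemma adj_Cons_blocks:
  assumes "\<And>j. hd (f j) = e" "\<And>j. f j \<noteq> []"
  shows "adj (x # concat (map f [0..<m]) @ e # ys) =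
    insert (x, e) ((\<Union>j<m. adj (f j @ [e])) \<union> adj (e # ys))"
proof -
  have "hd (concat (map f [0..<m]) @ e # ys) = e"
    using assms by (cases m) (simp_all add: upt_conv_Cons del: upt_Suc)
  then show ?thesis
    by (simp add: adj_Cons adj_blocks[OF assms])
qed

lemma adj_cyclic_nth:
  assumes "(a, b) \<in> adj (ds @ [hd ds])"
  shows "\<exists>i<length ds. a = ds ! i \<and> b = ds ! (Suc i mod length ds)"
proof (cases ds)
  case Nil
  with assms show ?thesis by (simp add: adj_def)
next
  case (Cons y zs)
  obtain i where "i < length ds" "a = (y # zs @ [y]) ! i" "b = (zs @ [y]) ! i"
    using assms unfolding Cons by (auto simp: adj_def set_zip)
  moreover from this have "a = ds ! i \<and> b = ds ! (Suc i mod length ds)"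
    by (cases "i = length zs") (auto simp: Cons nth_append nth_Cons')
  ultimately show ?thesis by blast
qed

section \<open>From integer words of steps to zigzag cycles\<close>

lemma T_class_card:
  assumes "A \<in> T_class n k" "k \<in> {2..int n - 2}"
  shows "card A = 3"
proof -
  obtain t where A: "A = translate n t ` {0, 1, k}"
    using assms(1) by (auto simp: T_class_def transp_class_def)
  have "inj_on (translate n t) {0..<int n}"
  proof (rule inj_onI)
    fix x y assume xy: "x \<in> {0..<int n}" "y \<in> {0..<int n}" "translate n t x = translate n t y"
    from xy(3) have "x mod int n = y mod int n"
      by (simp add: translate_def mod_eq_dvd_iff)
    with xy show "x = y" by simp
  qed
  then have "inj_on (translate n t) {0, 1, k}"
    using assms(2) by (elim inj_on_subset) auto
  then show ?thesis
    using assms(2) unfolding A by (subst card_image) auto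
qed

text \<open>With modulus \<open>0\<close>, \<^const>\<open>step_pairs\<close> consists of the pairs of unreduced integer steps.\<close>

lemma step_pairs_mod:
  assumes "(a, b) \<in> step_pairs 0 k" "\<kappa> \<in> {2..N - 2}" "N dvd k - \<kappa>"
  shows "(a mod N, b mod N) \<in> step_pairs N \<kappa>"
proof -
  have m: "u mod N = v" if "N dvd u - v" "0 \<le> v" "v < N" for u v :: int
    using that by (metis mod_eq_dvd_iff mod_pos_pos_trivial)
  obtain q where k: "k = \<kappa> + N * q" using assms(3) by (auto simp: dvd_def algebra_simps)
  have "1 mod N = 1" "(k - 1) mod N = \<kappa> - 1" "(- k) mod N = N - \<kappa>"
    "(- 1) mod N = N - 1" "k mod N = \<kappa>" "(1 - k) mod N = N + 1 - \<kappa>"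
    by (rule m; use assms(2) k in \<open>simp add: algebra_simps\<close>)+
  then show ?thesis
    using assms(1) unfolding step_pairs_def by (elim insertE emptyE; simp)
qed

text \<open>The pitches are the partial sums of \<open>ds\<close>. It suffices that each label
  occurs: there are \<open>n - 3\<close> labels for \<open>n - 3\<close> windows, each with at most
  one label, so none occurs twice. The pair \<open>(- 1, 2)\<close> is a zigzag traversal of the
  chromatic set.\<close>

lemma zigzag_of_steps:
  assumes n: "n \<ge> 6" and len: "length ds = n - 3" and sum: "sum_list ds = 0"
    and cov: "\<And>k. k \<in> {2..h} \<union> {h + 1 - int n..- 2} \<Longrightarrow> adj (ds @ [hd ds]) \<inter> step_pairs 0 k \<noteq> {}"
    and chrom: "(- 1, 2) \<in> adj (ds @ [hd ds])"
  shows "\<exists>c. zigzag_cycle n c"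
proof -
  define N where "N = int n"
  define m where "m = n - 3"
  define c where "c = map (\<lambda>i. sum_list (take i ds) mod N) [0..<m]"
  have N: "N \<ge> 6" using n by (simp add: N_def)
  have m: "m > 0" using n by (simp add: m_def)
  have lenc: "length c = m" by (simp add: c_def)
  have cyc: "cyc_nth c i = sum_list (take (i mod m) ds) mod N" for i
    using m by (simp add: cyc_nth_def lenc) (simp add: c_def)
  have step: "step n c i = ds ! (i mod m) mod N" for i
  proof -
    define r where "r = i mod m"
    have r: "r < m" using m by (simp add: r_def)
    have t: "sum_list (take (Suc r) ds) = sum_list (take r ds) + ds ! r"
      using r len by (simp add: m_def take_Suc_conv_app_nth)
    \<comment> \<open>At the wrap-around, the total 0 agrees with the empty partial sum at position
      0.\<close>
    have "cyc_nth c (i + 1) = sum_list (take (Suc r) ds) mod N"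
    proof (cases "Suc r = m")
      case True
      then show ?thesis
        using cyc[of "i + 1"] sum len by (simp add: r_def m_def mod_Suc)
    next
      case False
      then show ?thesis
        using cyc[of "i + 1"] by (simp add: r_def mod_Suc)
    qed
    then show ?thesis
      unfolding step_def cyc[of i] N_def[symmetric] r_def[symmetric] t by (simp add: mod_simps)
  qed
  have sub: "set c \<subseteq> {0..<int n}" and ne: "c \<noteq> []"
    using N m lenc by (auto simp: c_def N_def)
  note win = T_class_window_iff[OF sub ne, folded N_def]
  have adj: "\<exists>i<m. step n c i = a mod N \<and> step n c (i + 1) = b mod N"
    if "(a, b) \<in> adj (ds @ [hd ds])" for a b
    using adj_cyclic_nth[OF that] len by (auto simp: step m_def)
  have "\<exists>i<m. window c i \<in> T_class n k" if k: "k \<in> {2..N - 2}" for k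
  proof -
    \<comment> \<open>A label above \<open>h\<close> is met through its negative representative
      \<open>k - N\<close>.\<close>
    obtain k' where "k' \<in> {2..h} \<union> {h + 1 - int n..- 2}" "N dvd k' - k"
    proof (cases "k \<le> h")
      case True
      with k show ?thesis by (intro that[of k]) auto
    next
      case False
      with k show ?thesis by (intro that[of "k - N"]) (auto simp: N_def)
    qed
    with cov obtain a b where "(a, b) \<in> adj (ds @ [hd ds])" "(a, b) \<in> step_pairs 0 k'" by fast
    with adj[of a b] step_pairs_mod[of a b k' k N] \<open>N dvd k' - k\<close> k win[OF k]
    show ?thesis by auto
  qed
  then obtain pos where pos: "\<And>k. k \<in> {2..N - 2} \<Longrightarrow> pos k < m \<and> window c (pos k) \<in> T_class n k"
    by metis
  have disj: "k = l" if "window c i \<in> T_class n k" "window c i \<in> T_class n l"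
    "k \<in> {2..N - 2}" "l \<in> {2..N - 2}" for i k l
    using that win step_pairs_unique by metis
  have "inj_on pos {2..N - 2}"
    using pos disj by (intro inj_onI) metis
  then have surj: "pos ` {2..N - 2} = {..<m}"
    using pos card_image[of pos "{2..N - 2}"] n by (intro card_subset_eq) (auto simp: N_def m_def)
  have tri: "trichord_cycle n c"
    unfolding trichord_cycle_def lenc N_def[symmetric]
  proof (intro conjI allI impI ballI)
    show "m = n - 3" "set c \<subseteq> {0..<N}" using sub by (simp_all add: m_def N_def)
    fix i assume "i < m"
    then obtain k where "k \<in> {2..N - 2}" "i = pos k" using surj by (metis imageE lessThan_iff)
    then show "card (window c i) = 3" using pos T_class_card unfolding N_def by blast
  next
    fix k assume k: "k \<in> {2..N - 2}"
    show "\<exists>!i. i < m \<and> window c i \<in> T_class n k"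
    proof (rule ex1I[of _ "pos k"])
      show "pos k < m \<and> window c (pos k) \<in> T_class n k" by (rule pos[OF k])
      fix i assume i: "i < m \<and> window c i \<in> T_class n k"
      then obtain l where "l \<in> {2..N - 2}" "i = pos l" using surj by (metis imageE lessThan_iff)
      with i k pos disj show "i = pos k" by metis
    qed
  qed
  obtain i where i: "i < m" "step n c i = N - 1" "step n c (i + 1) = 2"
    using adj[OF chrom] N by (auto simp: zmod_minus1)
  have k2: "2 \<in> {2..N - 2}" using N by simp
  have "window c i \<in> T_class n 2"
    using win[OF k2, of i] i by (simp add: step_pairs_def)
  then have "chromatic_pos n c = i"
    unfolding chromatic_pos_def using tri k2 i(1) unfolding trichord_cycle_def lenc N_def
    by (intro the1_equality) blast+
  then have "\<not> scalar_cycle n c"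
    using scalar_cycle_iff[OF tri n] i N by simp
  with tri show ?thesis by (auto simp: zigzag_cycle_def)
qed

section \<open>The explicit words\<close>

lemma sum_list_concat: "sum_list (concat xss) = sum_list (map sum_list xss)"
  for xss :: "'a :: comm_monoid_add list list"
  by (induction xss) simp_all

text \<open>
  Six windows (steps \<open>-1, 2, -3, 4, 1\<close> and \<open>1, -3, -1\<close>) cover the labels \<open>2, 3, 4\<close> and \<open>-2, -3, -4\<close> while
  changing the sign of the unit steps.  The blocks \<open>f j\<close> and \<open>g j\<close> keep that sign and cover three
  consecutive positive, respectively negative, labels; an \<open>f\<close> block has sum 2, a \<open>g\<close> block sum \<open>-2\<close>.
\<close>

lemma zigzag_odd:
  assumes "n = 6 * b + 9"
  shows "\<exists>c. zigzag_cycle n c"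
proof -
  define f where "f j = [1, 3 * int j + 6, - (3 * int j + 5)]" for j
  define g where "g j = [- 1, - (3 * int j + 7), 3 * int j + 6]" for j
  define ds where
    "ds = [- 1, 2, - 3, 4] @ concat (map f [0..<b]) @ [1, - 3] @ concat (map g [0..<b])"
  have "adj (ds @ [hd ds]) = adj (- 1 # 2 # - 3 # 4 # concat (map f [0..<b]) @ 1 # - 3 # concat (map g [0..<b]) @ - 1 # [])"
    by (simp add: ds_def)
  also have "\<dots> = {(- 1, 2), (2, - 3), (- 3, 4), (4, 1), (1, - 3), (- 3, - 1)} \<union>
      (\<Union>j<b. adj (f j @ [1])) \<union> (\<Union>j<b. adj (g j @ [- 1]))"
    by (simp add: adj_Cons_blocks[of f 1] adj_Cons_blocks[of g "- 1"] f_def g_def)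
  finally have A: "adj (ds @ [hd ds]) = \<dots>" .
  have fg: "adj (f j @ [1]) \<union> adj (g j @ [- 1]) \<subseteq> adj (ds @ [hd ds])" if "j < b" for j
    using that unfolding A by blast
  show ?thesis
  \<comment> \<open>Here \<open>h = (n - 1) / 2\<close>, so the labels are the integers of absolute
    value from 2 to \<open>h\<close>.\<close>
  proof (rule zigzag_of_steps[of n ds "3 * int b + 4"])
    show "n \<ge> 6" using assms by simp
    show "length ds = n - 3"
      by (simp add: ds_def f_def g_def assms length_concat o_def sum_list_triv)
    show "sum_list ds = 0"
      by (simp add: ds_def f_def g_def sum_list_concat o_def sum_list_triv)
    show "(- 1, 2) \<in> adj (ds @ [hd ds])" unfolding A by simp
    fix k assume k: "k \<in> {2..3 * int b + 4} \<union> {3 * int b + 4 + 1 - int n..- 2}"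
    then consider "k \<in> {- 4, - 3, - 2, 2, 3, 4}" | "5 \<le> k" "k \<le> 3 * int b + 4"
      | "k \<le> - 5" "- (3 * int b + 4) \<le> k" using assms by fastforce
    then show "adj (ds @ [hd ds]) \<inter> step_pairs 0 k \<noteq> {}"
    proof cases
      case 1
      then show ?thesis unfolding A by (auto simp: step_pairs_def)
    next
      case 2
      define j where "j = nat ((k - 5) div 3)"
      have "j < b" "k \<in> {3 * int j + 5, 3 * int j + 6, 3 * int j + 7}" using 2 by (auto simp: j_def)
      then have "adj (f j @ [1]) \<inter> step_pairs 0 k \<noteq> {}"
        by (auto simp: f_def step_pairs_def)
      then show ?thesis using fg[OF \<open>j < b\<close>] by blast
    next
      case 3
      define j where "j = nat ((- k - 5) div 3)"
      have "j < b" "k \<in> {- (3 * int j + 5), - (3 * int j + 6), - (3 * int j + 7)}"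
        using 3 by (auto simp: j_def)
      then have "adj (g j @ [- 1]) \<inter> step_pairs 0 k \<noteq> {}"
        by (auto simp: g_def step_pairs_def)
      then show ?thesis using fg[OF \<open>j < b\<close>] by blast
    qed
  qed
qed

text \<open>
  For even \<open>n\<close> the labels \<open>q - 1, q, q + 1\<close> around \<open>q = n / 2\<close> need a block of their own, with sum \<open>-2\<close>.
  It is balanced by using \<open>3\<close> for \<open>-3\<close> after the \<open>f\<close> blocks and by covering \<open>5, 6, 7\<close> with unit steps
  \<open>-1\<close> rather than \<open>1\<close>.  That needs the labels \<open>5, 6, 7\<close> to be distinct from these, hence \<open>n \<ge> 18\<close>.
\<close>

lemma zigzag_even:
  assumes "n = 6 * t + 18"
  shows "\<exists>c. zigzag_cycle n c"
proof -
  define f where "f j = [1, 3 * int j + 9, - (3 * int j + 8)]" for j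
  define g where "g j = [- 1, - (3 * int j + 7), 3 * int j + 6]" for j
  \<comment> \<open>The labels 5, 6, 7 have their own steps near the end of the word, so there is
    one \<open>g\<close> block more than \<open>f\<close> blocks. The total is
    \<open>6 + 2 * t - 2 * u - 4 = 0\<close>.\<close>
  define u where "u = t + 1"
  define q where "q = 3 * int t + 9"
  define ds where
    "ds = [- 1, 2, - 3, 4] @ concat (map f [0..<t]) @ [1, 3] @ concat (map g [0..<u]) @
       [- 1, 5, - 6, - 1, q - 1, - q]"
  have "adj (ds @ [hd ds]) = adj (- 1 # 2 # - 3 # 4 # concat (map f [0..<t]) @ 1 # 3 #
      concat (map g [0..<u]) @ - 1 # [5, - 6, - 1, q - 1, - q, - 1])"
    by (simp add: ds_def)
  also have "\<dots> = {(- 1, 2), (2, - 3), (- 3, 4), (4, 1), (1, 3), (3, - 1), (- 1, 5), (5, - 6), (- 6, - 1),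
        (- 1, q - 1), (q - 1, - q), (- q, - 1)} \<union>
      (\<Union>j<t. adj (f j @ [1])) \<union> (\<Union>j<u. adj (g j @ [- 1]))"
    by (simp add: adj_Cons_blocks[of f 1] adj_Cons_blocks[of g "- 1"] f_def g_def)
  finally have A: "adj (ds @ [hd ds]) = \<dots>" .
  have f_sub: "adj (f j @ [1]) \<subseteq> adj (ds @ [hd ds])" if "j < t" for j
    using that unfolding A by blast
  have g_sub: "adj (g j @ [- 1]) \<subseteq> adj (ds @ [hd ds])" if "j < u" for j
    using that unfolding A by blast
  show ?thesis
  \<comment> \<open>The middle block represents its labels by \<open>q - 1\<close>,
    \<open>q\<close>, \<open>q + 1\<close>, so the cut lies at \<open>q + 1\<close> and the negative
    labels stop at \<open>2 - q\<close>.\<close>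
  proof (rule zigzag_of_steps[of n ds "q + 1"])
    show "n \<ge> 6" using assms by simp
    show "length ds = n - 3"
      by (simp add: ds_def f_def g_def u_def assms length_concat o_def sum_list_triv)
    show "sum_list ds = 0"
      by (simp add: ds_def f_def g_def u_def sum_list_concat o_def sum_list_triv)
    show "(- 1, 2) \<in> adj (ds @ [hd ds])" unfolding A by simp
    fix k assume "k \<in> {2..q + 1} \<union> {q + 1 + 1 - int n..- 2}"
    moreover have "int n = 2 * q" using assms by (simp add: q_def)
    ultimately have "2 \<le> k \<and> k \<le> q + 1 \<or> 2 - q \<le> k \<and> k \<le> - 2" by auto
    then have "k \<in> {- 4, - 3, - 2, 2, 3, 4, 5, 6, 7} \<or> k \<in> {q - 1, q, q + 1} \<or>
        8 \<le> k \<and> k \<le> q - 2 \<or> k \<le> - 5 \<and> 2 - q \<le> k"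
      unfolding insert_iff empty_iff by presburger
    then show "adj (ds @ [hd ds]) \<inter> step_pairs 0 k \<noteq> {}"
    proof (elim disjE conjE)
      assume "k \<in> {- 4, - 3, - 2, 2, 3, 4, 5, 6, 7}"
      then have "{(- 1, 2), (2, - 3), (- 3, 4), (4, 1), (1, 3), (3, - 1), (- 1, 5), (5, - 6), (- 6, - 1)} \<inter>
          step_pairs 0 k \<noteq> {}"
        by (elim insertE emptyE) (simp_all add: step_pairs_def)
      then show ?thesis unfolding A by blast
    next
      assume "k \<in> {q - 1, q, q + 1}"
      then have "{(- 1, q - 1), (q - 1, - q), (- q, - 1)} \<inter> step_pairs 0 k \<noteq> {}"
        by (elim insertE emptyE) (simp_all add: step_pairs_def)
      then show ?thesis unfolding A by blast
    next
      assume 2: "8 \<le> k" "k \<le> q - 2"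
      define j where "j = nat ((k - 8) div 3)"
      have j: "j < t" "k \<in> {3 * int j + 8, 3 * int j + 9, 3 * int j + 10}"
        using 2 by (auto simp: j_def q_def u_def)
      then have "adj (f j @ [1]) \<inter> step_pairs 0 k \<noteq> {}"
        by (auto simp: f_def step_pairs_def)
      then show ?thesis using f_sub[OF j(1)] by blast
    next
      assume 3: "k \<le> - 5" "2 - q \<le> k"
      define j where "j = nat ((- k - 5) div 3)"
      have j: "j < u" "k \<in> {- (3 * int j + 5), - (3 * int j + 6), - (3 * int j + 7)}"
        using 3 by (auto simp: j_def q_def u_def)
      then have "adj (g j @ [- 1]) \<inter> step_pairs 0 k \<noteq> {}"
        by (auto simp: g_def step_pairs_def)
      then show ?thesis using g_sub[OF j(1)] by blast
    qed
  qed
qed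

theorem theorem8p3:
  fixes n :: nat
  assumes "n \<ge> 6"
  shows "(\<exists>c. zigzag_cycle n c) \<longleftrightarrow> 3 dvd n \<and> n \<notin> {6, 12}"
proof
  assume "\<exists>c. zigzag_cycle n c"
  then obtain c where c: "zigzag_cycle n c" ..
  have "n \<noteq> 6"
    using zigzag_imp_closes[OF c assms] no_closes_6 by (auto simp: upto.simps)
  moreover have "n \<noteq> 12"
    using zigzag_imp_closes[OF c assms] no_closes_12 by (auto simp: upto.simps)
  ultimately show "3 dvd n \<and> n \<notin> {6, 12}"
    using zigzag_imp_three_dvd[OF c assms] by simp
next
  assume n: "3 dvd n \<and> n \<notin> {6, 12}"
  show "\<exists>c. zigzag_cycle n c"
  proof (cases "odd n")
    case True
    \<comment> \<open>Odd multiples of 3 from 6 on are at least 9, and even ones other than 6 and 12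
      at least 18, so neither subtraction truncates.\<close>
    have "n = 6 * ((n - 9) div 6) + 9" using True n assms by (elim conjE) presburger
    then show ?thesis by (rule zigzag_odd)
  next
    case False
    have "n = 6 * ((n - 18) div 6) + 18" using False n assms by (elim conjE) (simp; presburger)
    then show ?thesis by (rule zigzag_even)
  qed
qed

end
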